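(* Consider a POMDP with finite state space $\mathcal S$, observation space $\mathcal O$, action space $\mathcal A$, transition kernel $\alpha$, observation kernel $\beta$, reward function $r$ and discount factor $\gamma\in(0,1)$. Fix orderings of $\mathcal O$ and $\mathcal A$, and write a stochastic memoryless policy as a vector $P\in\mathbb R^{|\mathcal O||\mathcal A|}$ with entries satisfying $P(a|o)\ge0$ and $\sum_{a\in\mathcal A}P(a|o)=1$ for all $o\in\mathcal O$. For $x\in\mathbb R^{\mathcal S}$ and $(o,a)\in\mathcal O\times\mathcal A$ define $u_{o,a}(x)\in\mathbb R^{|\mathcal S|}$ by $$u_{o,a}(x)_s=\beta(s;o)\Big(\gamma\sum_{s'\in\mathcal S}\alpha(s,a;s')x_{s'}+r(s,a)\Big).$$ Let $d(x)=x$, let $R\in\mathbb R^{|\mathcal O|\times|\mathcal O||\mathcal A|}$ be the matrix with $(RP)_o=\sum_{a\in\mathcal A}P(a|o)$, let $M(x)\in\mathbb R^{|\mathcal S|\times|\mathcal O||\mathcal A|}$ be the matrix with columns $u_{o,a}(x)$, and set $$C(x)=\begin{pmatrix}M(x)\\R\end{pmatrix},\qquad f(x)=\begin{pmatrix}d(x)\\ \mathbf 1_{|\mathcal O|}\end{pmatrix}.$$ Then $x$ is a feasible value function if and only if there exists $P\in\mathbb R^{|\mathcal O||\mathcal A|}$ with $C(x)P=f(x)$ and $P\ge0$. Moreover, the set $\mathcal V\subseteq\mathbb R^{\mathcal S}$ of feasible value functions admits the following quantifier-free semi-algebraic description, as a finite union stratified by $\operatorname{rank}C(x)=\rho$: $$\mathcal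 V=\bigcup_{\rho=1}^{|\mathcal S|+|\mathcal O|}\ \bigcup_{\substack{I\subseteq\{1,\dots,|\mathcal S|+|\mathcal O|\}\\|I|=\rho}}\ \bigcup_{\substack{B\subseteq\{1,\dots,|\mathcal O||\mathcal A|\}\\|B|=\rho}}S_{\rho,I,B},$$ where $S_{\rho,I,B}$ is the set of all $x\in\mathbb R^{\mathcal S}$ such that: (i) $\det C_{I,B}(x)\ne0$ and every $(\rho+1)\times(\rho+1)$ minor of $C(x)$ vanishes; (ii) every $(\rho+1)\times(\rho+1)$ minor of the augmented matrix $[C(x)\,|\,f(x)]$ vanishes; (iii) for all $t=1,\dots,\rho$, $\det C_{I,B,t}(x)\,\det C_{I,B}(x)\ge0$. Here $C_{I,B}(x)$ is the $\rho\times\rho$ submatrix of $C(x)$ with row set $I$ and column set $B$, and $C_{I,B,t}(x)$ is obtained from $C_{I,B}(x)$ by replacing its $t$-th column by $f_I(x)$, the subvector of $f(x)$ with entries indexed by $I$.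
   Context: $\mathcal S,\mathcal A,\mathcal O$ are nonempty. $\alpha(s,a;s')=\alpha(s'|s,a)\ge0$ with $\sum_{s'}\alpha(s,a;s')=1$; $\beta(s;o)=\beta(o|s)\ge0$ with $\sum_o\beta(s;o)=1$; $r:\mathcal S\times\mathcal A\to\mathbb R$. For a stochastic memoryless policy $\pi$ (that is, $\pi(a|o)\ge0$, $\sum_a\pi(a|o)=1$ for each $o$) put $\tau(a|s)=\sum_o\pi(a|o)\beta(s;o)$, $P^\pi(s'|s)=\sum_a\tau(a|s)\alpha(s,a;s')$ (a matrix with rows $s$ and columns $s'$), and $r^\pi(s)=\sum_a\tau(a|s)r(s,a)$. A vector $x\in\mathbb R^{\mathcal S}$ is a feasible value function if it solves the Bellman equation $(I-\gamma P^\pi)x=r^\pi$ for some stochastic memoryless policy $\pi$. Conditions on minors of a size for which no minors exist are vacuous. *)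

theory Defs
  imports "HOL-Analysis.Analysis" "Jordan_Normal_Form.DL_Rank_Submatrix"
begin

(* Vectors indexed by the state space are HOL-Analysis vectors (real ^ 's); the matrices whose
   minors are taken are matrices of Jordan_Normal_Form.  The symbol $ is kept for the latter. *)
no_notation vec_nth (infixl \<open>$\<close> 90)
notation vec_nth (infixl \<open>$h\<close> 90)


definition memoryless_policy :: "('o::finite \<Rightarrow> 'a::finite \<Rightarrow> real) \<Rightarrow> bool" where
  "memoryless_policy \<pi> \<longleftrightarrow> (\<forall>w a. \<pi> w a \<ge> 0) \<and> (\<forall>w. (\<Sum>a\<in>UNIV. \<pi> w a) = 1)"

definition effective_policy ::
  "('s \<Rightarrow> 'o::finite \<Rightarrow> real) \<Rightarrow> ('o \<Rightarrow> 'a \<Rightarrow> real) \<Rightarrow> 's \<Rightarrow> 'a \<Rightarrow> real" where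
  "effective_policy \<beta> \<pi> s a = (\<Sum>w\<in>UNIV. \<pi> w a * \<beta> s w)"

definition policy_transition ::
  "('s::finite \<Rightarrow> 'a::finite \<Rightarrow> 's \<Rightarrow> real) \<Rightarrow> ('s \<Rightarrow> 'o::finite \<Rightarrow> real) \<Rightarrow> ('o \<Rightarrow> 'a \<Rightarrow> real)
     \<Rightarrow> real ^ 's ^ 's" where
  "policy_transition \<alpha> \<beta> \<pi> = (\<chi> s s'. \<Sum>a\<in>UNIV. effective_policy \<beta> \<pi> s a * \<alpha> s a s')"

definition policy_reward ::
  "('s::finite \<Rightarrow> 'o::finite \<Rightarrow> real) \<Rightarrow> ('s \<Rightarrow> 'a::finite \<Rightarrow> real) \<Rightarrow> ('o \<Rightarrow> 'a \<Rightarrow> real)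
     \<Rightarrow> real ^ 's" where
  "policy_reward \<beta> r \<pi> = (\<chi> s. \<Sum>a\<in>UNIV. effective_policy \<beta> \<pi> s a * r s a)"

definition feasible_value_functions ::
  "('s::finite \<Rightarrow> 'a::finite \<Rightarrow> 's \<Rightarrow> real) \<Rightarrow> ('s \<Rightarrow> 'o::finite \<Rightarrow> real) \<Rightarrow> ('s \<Rightarrow> 'a \<Rightarrow> real)
     \<Rightarrow> real \<Rightarrow> (real ^ 's) set" where
  "feasible_value_functions \<alpha> \<beta> r \<gamma> =
     {x. \<exists>\<pi>. memoryless_policy \<pi> \<and>
        (Finite_Cartesian_Product.mat 1 - \<gamma> *\<^sub>R policy_transition \<alpha> \<beta> \<pi>) *v x
          = policy_reward \<beta> r \<pi>}"


definition u_vec ::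
  "('s::finite \<Rightarrow> 'a \<Rightarrow> 's \<Rightarrow> real) \<Rightarrow> ('s \<Rightarrow> 'o \<Rightarrow> real) \<Rightarrow> ('s \<Rightarrow> 'a \<Rightarrow> real) \<Rightarrow> real
     \<Rightarrow> real ^ 's \<Rightarrow> 'o \<Rightarrow> 'a \<Rightarrow> real ^ 's" where
  "u_vec \<alpha> \<beta> r \<gamma> x w a = (\<chi> s. \<beta> s w * (\<gamma> * (\<Sum>s'\<in>UNIV. \<alpha> s a s' * x $h s') + r s a))"

text \<open>
  An ordering of a finite type is a list enumerating it.  Observation-action pairs are ordered
  lexicographically, as in \<open>List.product Os As\<close>; this is the indexing of policy vectors and of
  the columns of the matrices below.  Row and column indices are counted from 0.
\<close>

definition enumerates :: "'b list \<Rightarrow> bool" where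
  "enumerates xs \<longleftrightarrow> distinct xs \<and> set xs = UNIV"

definition coord_vec :: "'s::finite list \<Rightarrow> real ^ 's \<Rightarrow> real Matrix.vec" where
  "coord_vec Ss x = Matrix.vec (length Ss) (\<lambda>i. x $h (Ss ! i))"

definition M_mat ::
  "('s::finite \<Rightarrow> 'a \<Rightarrow> 's \<Rightarrow> real) \<Rightarrow> ('s \<Rightarrow> 'o \<Rightarrow> real) \<Rightarrow> ('s \<Rightarrow> 'a \<Rightarrow> real) \<Rightarrow> real
     \<Rightarrow> 's list \<Rightarrow> 'o list \<Rightarrow> 'a list \<Rightarrow> real ^ 's \<Rightarrow> real Matrix.mat" where
  "M_mat \<alpha> \<beta> r \<gamma> Ss Os As x =
     mat_of_cols (length Ss)
       (map (\<lambda>(w, a). coord_vec Ss (u_vec \<alpha> \<beta> r \<gamma> x w a)) (List.product Os As))"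

(* The matrix with (R P)_w = sum_a P(a|w). *)
definition R_mat :: "'o list \<Rightarrow> 'a list \<Rightarrow> real Matrix.mat" where
  "R_mat Os As =
     Matrix.mat (length Os) (length Os * length As)
       (\<lambda>(i, j). if fst (List.product Os As ! j) = Os ! i then 1 else 0)"

definition C_mat ::
  "('s::finite \<Rightarrow> 'a \<Rightarrow> 's \<Rightarrow> real) \<Rightarrow> ('s \<Rightarrow> 'o \<Rightarrow> real) \<Rightarrow> ('s \<Rightarrow> 'a \<Rightarrow> real) \<Rightarrow> real
     \<Rightarrow> 's list \<Rightarrow> 'o list \<Rightarrow> 'a list \<Rightarrow> real ^ 's \<Rightarrow> real Matrix.mat" where
  "C_mat \<alpha> \<beta> r \<gamma> Ss Os As x = M_mat \<alpha> \<beta> r \<gamma> Ss Os As x @\<^sub>r R_mat Os As"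

definition f_vec :: "'s::finite list \<Rightarrow> 'o list \<Rightarrow> real ^ 's \<Rightarrow> real Matrix.vec" where
  "f_vec Ss Os x = coord_vec Ss x @\<^sub>v Matrix.vec (length Os) (\<lambda>_. 1)"


definition augmented_mat :: "'b Matrix.mat \<Rightarrow> 'b Matrix.vec \<Rightarrow> 'b Matrix.mat" where
  "augmented_mat A b = mat_of_cols (dim_row A) (cols A @ [b])"

definition minors :: "nat \<Rightarrow> real Matrix.mat \<Rightarrow> real set" where
  "minors k A = {Determinant.det (submatrix A I J) | I J.
     I \<subseteq> {..<dim_row A} \<and> J \<subseteq> {..<dim_col A} \<and> card I = k \<and> card J = k}"

(* pick I i is the i-th smallest element of I, as in submatrix *)
definition subvector :: "'b Matrix.vec \<Rightarrow> nat set \<Rightarrow> 'b Matrix.vec" where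
  "subvector v I = Matrix.vec (card {i. i < dim_vec v \<and> i \<in> I}) (\<lambda>i. v $ pick I i)"

definition stratum ::
  "('s::finite \<Rightarrow> 'a \<Rightarrow> 's \<Rightarrow> real) \<Rightarrow> ('s \<Rightarrow> 'o \<Rightarrow> real) \<Rightarrow> ('s \<Rightarrow> 'a \<Rightarrow> real) \<Rightarrow> real
     \<Rightarrow> 's list \<Rightarrow> 'o list \<Rightarrow> 'a list \<Rightarrow> nat \<Rightarrow> nat set \<Rightarrow> nat set \<Rightarrow> (real ^ 's) set" where
  "stratum \<alpha> \<beta> r \<gamma> Ss Os As \<rho> I B =
     {x. let C = C_mat \<alpha> \<beta> r \<gamma> Ss Os As x; f = f_vec Ss Os x; C_IB = submatrix C I B in
        Determinant.det C_IB \<noteq> 0 \<and>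
        (\<forall>m \<in> minors (\<rho> + 1) C. m = 0) \<and>
        (\<forall>m \<in> minors (\<rho> + 1) (augmented_mat C f). m = 0) \<and>
        (\<forall>t<\<rho>. Determinant.det (replace_col C_IB (subvector f I) t) * Determinant.det C_IB \<ge> 0)}"

(* Sets defined by quantifier-free formulas over the atoms p = 0 and p > 0, p a polynomial. *)
inductive semialgebraic :: "(real ^ 'n) set \<Rightarrow> bool" where
  zero: "real_polynomial_function p \<Longrightarrow> semialgebraic {x. p x = 0}"
| pos: "real_polynomial_function p \<Longrightarrow> semialgebraic {x. p x > 0}"
| compl: "semialgebraic A \<Longrightarrow> semialgebraic (- A)"
| inter: "semialgebraic A \<Longrightarrow> semialgebraic B \<Longrightarrow> semialgebraic (A \<inter> B)"
| union: "semialgebraic A \<Longrightarrow> semialgebraic B \<Longrightarrow> semialgebraic (A \<union> B)"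

end

(* The Bellman equation for a policy P is linear in the entries P(a|o), so together with the
   normalisation of P it reads C(x) P = f(x), P >= 0.  A feasible system of this form has a solution
   supported on linearly independent columns (Caratheodory); extending the support to a column
   basis B and choosing rows I with det C_{I,B} nonzero, the ranks of C and [C|f] are both |B|, and
   Cramer's rule turns nonnegativity of the solution into the sign conditions.  Conversely, when
   det C_{I,B} is nonzero and all bordered minors of [C|f] vanish, solving on the rows I solves all
   rows. *)
theory Submission
  imports Defs
begin


section \<open>Minors and column dependences\<close>

text \<open>No basis can be fixed in advance: at a given rank many pairs \<open>I\<close>,
  \<open>B\<close> have a nonzero minor, and only some of these \<open>B\<close> carry a nonnegative
  solution, hence the union over all pairs. The support of the solution with independent columns
  cannot itself serve as \<open>B\<close>: it may be smaller than the rank, and then some minor one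
  size larger survives. Padding it to a basis adds columns of weight zero, which is why the sign
  conditions must be weak inequalities. Since the columns in \<open>B\<close> are independent, the
  solution supported on \<open>B\<close> is unique and its coordinates are Cramer quotients.
  Multiplying such a quotient by the square of its denominator keeps the sign and leaves a
  polynomial inequality, so the description needs no division. The case \<rho> = 0 never arises
  because the block of ones makes the right-hand side nonzero. Dependences are phrased with index
  sets and coefficients on indices rather than with sets of vectors: different observation-action
  pairs may give equal columns, and index sets are what submatrices take. Sets of vectors appear
  only in the computation of the rank.\<close>

definition independent_columns :: "(nat \<Rightarrow> nat \<Rightarrow> 'a::field) \<Rightarrow> nat set \<Rightarrow> nat set \<Rightarrow> bool" where
  "independent_columns A I J \<longleftrightarrow>
     (\<forall>c. (\<forall>i\<in>I. (\<Sum>j\<in>J. A i j * c j) = 0) \<longrightarrow> (\<forall>j\<in>J. c j = 0))"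

lemma independent_columnsD:
  assumes "independent_columns A I J" and "\<And>i. i \<in> I \<Longrightarrow> (\<Sum>j\<in>J. A i j * c j) = 0" and "j \<in> J"
  shows "c j = 0"
  using assms unfolding independent_columns_def by blast

lemma independent_columns_mono:
  assumes "independent_columns A I J" and "I \<subseteq> I'"
  shows "independent_columns A I' J"
  using assms unfolding independent_columns_def by blast

lemma independent_columns_subset:
  assumes "independent_columns A I J" and "J' \<subseteq> J" and "finite J"
  shows "independent_columns A I J'"
  unfolding independent_columns_def
proof (intro allI impI ballI)
  fix c j assume c: "\<forall>i\<in>I. (\<Sum>j\<in>J'. A i j * c j) = 0" and j: "j \<in> J'"
  define d where "d = (\<lambda>j. if j \<in> J' then c j else 0)"
  have "(\<Sum>j\<in>J. A i j * d j) = 0" if "i \<in> I" for i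
  proof -
    have "(\<Sum>j\<in>J. A i j * d j) = (\<Sum>j\<in>J'. A i j * c j)"
      using assms(2,3) by (intro sum.mono_neutral_cong_right) (auto simp: d_def)
    then show ?thesis using c that by simp
  qed
  from independent_columnsD[OF assms(1) this, of j] show "c j = 0"
    using j assms(2) by (auto simp: d_def)
qed

section \<open>Submatrices, their order-preserving enumerations and their determinants\<close>

lemma bij_betw_pick:
  assumes "finite J"
  shows "bij_betw (pick J) {..<card J} J"
proof (rule bij_betw_imageI)
  show inj: "inj_on (pick J) {..<card J}"
  proof (rule linorder_inj_onI')
    fix i j assume "i \<in> {..<card J}" "j \<in> {..<card J}" "i < j"
    then show "pick J i \<noteq> pick J j" using pick_mono_le[of j J i] by auto
  qed
  have "pick J ` {..<card J} \<subseteq> J" using pick_in_set_le by auto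
  then show "pick J ` {..<card J} = J"
    using inj assms by (simp add: card_image card_subset_eq)
qed

lemma set_of_less: "J \<subseteq> {..<n} \<Longrightarrow> {j. j < n \<and> j \<in> J} = J"
  by auto

lemma submatrix_carrier:
  assumes "I \<subseteq> {..<dim_row A}" and "J \<subseteq> {..<dim_col A}"
  shows "submatrix A I J \<in> carrier_mat (card I) (card J)"
  using assms by (auto simp: dim_submatrix set_of_less)

lemma index_submatrix:
  assumes "I \<subseteq> {..<dim_row A}" and "J \<subseteq> {..<dim_col A}" and "i < card I" and "j < card J"
  shows "submatrix A I J $$ (i, j) = A $$ (pick I i, pick J j)"
  using assms by (intro submatrix_index) (auto simp: set_of_less)

lemma index_subvector:
  assumes "I \<subseteq> {..<dim_vec v}" and "i < card I"
  shows "subvector v I $ i = v $ pick I i"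
  using assms by (simp add: subvector_def set_of_less)

lemma dim_subvector: "I \<subseteq> {..<dim_vec v} \<Longrightarrow> dim_vec (subvector v I) = card I"
  by (simp add: subvector_def set_of_less)

text \<open>Reindexing along \<open>pick\<close> turns the ordered product into a sum over the set
  \<open>J\<close>, so that later arguments need not see the ordering.\<close>

lemma index_submatrix_mult_vec:
  fixes A :: "'a::comm_semiring_0 mat"
  assumes I: "I \<subseteq> {..<dim_row A}" and J: "J \<subseteq> {..<dim_col A}" and i: "i < card I"
  shows "(submatrix A I J *\<^sub>v vec (card J) (\<lambda>j. c (pick J j))) $ i
           = (\<Sum>j\<in>J. A $$ (pick I i, j) * c j)"
proof -
  have fin: "finite J" using J finite_subset by blast
  have dims: "dim_row (submatrix A I J) = card I" "dim_col (submatrix A I J) = card J"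
    using submatrix_carrier[OF I J] by auto
  have "(submatrix A I J *\<^sub>v vec (card J) (\<lambda>j. c (pick J j))) $ i
      = (\<Sum>j<card J. A $$ (pick I i, pick J j) * c (pick J j))"
    using i dims by (auto simp: scalar_prod_def index_submatrix[OF I J] intro!: sum.cong)
  also have "\<dots> = (\<Sum>j\<in>J. A $$ (pick I i, j) * c j)"
    using sum.reindex_bij_betw[OF bij_betw_pick[OF fin], of "\<lambda>j. A $$ (pick I i, j) * c j"] by simp
  finally show ?thesis .
qed

text \<open>A square matrix over a field is singular exactly when its kernel is nontrivial, and
  kernel vectors of the block are the coefficient functions on \<open>J\<close> read through
  \<open>pick\<close>. This is the passage between determinants and dependences.\<close>

lemma det_submatrix_nonzero_iff:
  fixes A :: "'a::field mat"
  assumes I: "I \<subseteq> {..<dim_row A}" and J: "J \<subseteq> {..<dim_col A}" and card: "card I = card J"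
  shows "det (submatrix A I J) \<noteq> 0 \<longleftrightarrow> independent_columns (\<lambda>i j. A $$ (i, j)) I J"
proof -
  have finI: "finite I" and finJ: "finite J" using I J finite_subset by blast+
  have carr: "submatrix A I J \<in> carrier_mat (card J) (card J)"
    using submatrix_carrier[OF I J] card by simp
  have pickJ: "pick J ` {..<card J} = J" and pickI: "pick I ` {..<card I} = I"
    using bij_betw_pick finI finJ by (auto simp: bij_betw_def)
  show ?thesis
  proof
    assume det: "det (submatrix A I J) \<noteq> 0"
    show "independent_columns (\<lambda>i j. A $$ (i, j)) I J"
      unfolding independent_columns_def
    proof (intro allI impI ballI)
      fix c j assume c: "\<forall>i\<in>I. (\<Sum>j\<in>J. A $$ (i, j) * c j) = 0" and j: "j \<in> J"
      let ?v = "vec (card J) (\<lambda>j. c (pick J j))"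
      have "submatrix A I J *\<^sub>v ?v = 0\<^sub>v (card J)"
        using carr card c pickI
        by (intro eq_vecI) (auto simp: index_submatrix_mult_vec[OF I J] pick_in_set_le simp del: index_mult_mat_vec)
      then have "?v = 0\<^sub>v (card J)"
        using det det_0_iff_vec_prod_zero_field[OF carr] vec_carrier by blast
      then have "c (pick J k) = 0" if "k < card J" for k
        using that by (metis index_vec index_zero_vec(1))
      then show "c j = 0" using j pickJ by (metis imageE lessThan_iff)
    qed
  next
    assume ns: "independent_columns (\<lambda>i j. A $$ (i, j)) I J"
    show "det (submatrix A I J) \<noteq> 0"
    proof
      assume "det (submatrix A I J) = 0"
      then obtain v where v: "v \<in> carrier_vec (card J)" "v \<noteq> 0\<^sub>v (card J)"
        "submatrix A I J *\<^sub>v v = 0\<^sub>v (card J)"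
        using det_0_iff_vec_prod_zero_field[OF carr] by auto
      \<comment> \<open>Undoing \<open>pick J\<close> turns positions inside the block back into
        column indices of \<open>A\<close>.\<close>
      define c where "c = (\<lambda>j. v $ the_inv_into {..<card J} (pick J) j)"
      have cpick: "c (pick J k) = v $ k" if "k < card J" for k
        using that bij_betw_pick[OF finJ] by (simp add: c_def bij_betw_def the_inv_into_f_f)
      have veq: "v = vec (card J) (\<lambda>j. c (pick J j))"
        using v(1) by (intro eq_vecI) (auto simp: cpick)
      have "(\<Sum>j\<in>J. A $$ (i, j) * c j) = 0" if "i \<in> I" for i
      proof -
        from that pickI obtain k where k: "k < card I" "i = pick I k" by blast
        then show ?thesis
          using index_submatrix_mult_vec[OF I J k(1), of c] v(3) veq card by simp
      qed
      from independent_columnsD[OF ns this] have "c j = 0" if "j \<in> J" for j using that by blast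
      then have "v = 0\<^sub>v (card J)"
        using v(1) cpick pick_in_set_le by (intro eq_vecI) (metis carrier_vecD index_zero_vec(1,2))+
      then show False using v(2) by simp
    qed
  qed
qed

text \<open>The adjugate inverts \<open>A\<close> up to the factor \<open>det A\<close>; scaling
  \<open>b\<close> by the reciprocal gives an explicit solution.\<close>

lemma solve_square_system:
  fixes A :: "'a::field mat"
  assumes A: "A \<in> carrier_mat n n" and det: "det A \<noteq> 0" and b: "b \<in> carrier_vec n"
  obtains y where "y \<in> carrier_vec n" and "A *\<^sub>v y = b"
proof
  let ?y = "adj_mat A *\<^sub>v ((1 / det A) \<cdot>\<^sub>v b)"
  note adj = adj_mat[OF A]
  show "?y \<in> carrier_vec n" using adj(1) b by simp
  have "A *\<^sub>v ?y = (A * adj_mat A) *\<^sub>v ((1 / det A) \<cdot>\<^sub>v b)"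
    using A adj(1) b by simp
  also have "\<dots> = det A \<cdot>\<^sub>v (1\<^sub>m n *\<^sub>v ((1 / det A) \<cdot>\<^sub>v b))"
    unfolding adj(2) using b by (intro eq_vecI) (auto simp: smult_scalar_prod_distrib)
  also have "\<dots> = b" using b det by (simp add: smult_smult_assoc)
  finally show "A *\<^sub>v ?y = b" .
qed

lemma submatrix_system_solvable:
  fixes A :: "'a::field mat"
  assumes I: "I \<subseteq> {..<dim_row A}" and J: "J \<subseteq> {..<dim_col A}" and card: "card I = card J"
    and det: "det (submatrix A I J) \<noteq> 0"
  obtains c where "\<And>i. i \<in> I \<Longrightarrow> (\<Sum>j\<in>J. A $$ (i, j) * c j) = b i"
proof -
  have finI: "finite I" and finJ: "finite J" using I J finite_subset by blast+
  have carr: "submatrix A I J \<in> carrier_mat (card J) (card J)"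
    using submatrix_carrier[OF I J] card by simp
  obtain v where v: "v \<in> carrier_vec (card J)"
    "submatrix A I J *\<^sub>v v = vec (card J) (\<lambda>i. b (pick I i))"
    using solve_square_system[OF carr det, of "vec (card J) (\<lambda>i. b (pick I i))"] by auto
  define c where "c = (\<lambda>j. v $ the_inv_into {..<card J} (pick J) j)"
  have "v = vec (card J) (\<lambda>j. c (pick J j))"
    using v(1) bij_betw_pick[OF finJ]
    by (intro eq_vecI) (auto simp: c_def bij_betw_def the_inv_into_f_f)
  have "(\<Sum>j\<in>J. A $$ (i, j) * c j) = b i" if "i \<in> I" for i
  proof -
    from that bij_betw_pick[OF finI] obtain k where k: "k < card I" "i = pick I k"
      by (auto simp: bij_betw_def)
    have "(\<Sum>j\<in>J. A $$ (i, j) * c j) = (submatrix A I J *\<^sub>v vec (card J) (\<lambda>j. c (pick J j))) $ k"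
      using index_submatrix_mult_vec[OF I J k(1), of c] k(2) by simp
    also have "\<dots> = b i" using v(2) \<open>v = _\<close>[symmetric] k card by simp
    finally show ?thesis .
  qed
  then show thesis using that by blast
qed

text \<open>The bordering argument: the column \<open>j\<close> is solved for on the rows \<open>I\<close>; a row \<open>i\<close> on which the
  solution fails would make the bordered block nonsingular.\<close>

lemma column_in_span_or_border:
  fixes A :: "'a::field mat"
  assumes I: "I \<subseteq> {..<dim_row A}" and J: "J \<subseteq> {..<dim_col A}" and card: "card I = card J"
    and det: "det (submatrix A I J) \<noteq> 0" and j: "j < dim_col A" "j \<notin> J"
  obtains (span) c where "\<And>i. i < dim_row A \<Longrightarrow> A $$ (i, j) = (\<Sum>k\<in>J. A $$ (i, k) * c k)"
  | (border) i where "i < dim_row A" and "i \<notin> I"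
      and "det (submatrix A (insert i I) (insert j J)) \<noteq> 0"
proof -
  have finI: "finite I" and finJ: "finite J" using I J finite_subset by blast+
  have ns: "independent_columns (\<lambda>i j. A $$ (i, j)) I J"
    using det det_submatrix_nonzero_iff[OF I J card] by simp
  obtain c where c: "\<And>i. i \<in> I \<Longrightarrow> (\<Sum>k\<in>J. A $$ (i, k) * c k) = A $$ (i, j)"
    using submatrix_system_solvable[OF I J card det, of "\<lambda>i. A $$ (i, j)"] by auto
  show thesis
  proof (cases "\<exists>i<dim_row A. A $$ (i, j) \<noteq> (\<Sum>k\<in>J. A $$ (i, k) * c k)")
    case False
    then show thesis using span by blast
  next
    case True
    then obtain i where i: "i < dim_row A" "A $$ (i, j) \<noteq> (\<Sum>k\<in>J. A $$ (i, k) * c k)" by blast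
    then have iI: "i \<notin> I" using c by metis
    have "independent_columns (\<lambda>i j. A $$ (i, j)) (insert i I) (insert j J)"
      unfolding independent_columns_def
    proof (intro allI impI)
      fix d assume d: "\<forall>l\<in>insert i I. (\<Sum>k\<in>insert j J. A $$ (l, k) * d k) = 0"
      have dsum: "A $$ (l, j) * d j + (\<Sum>k\<in>J. A $$ (l, k) * d k) = 0" if "l \<in> insert i I" for l
        using bspec[OF d that] finJ j(2) by simp
      \<comment> \<open>Substituting the expression of column \<open>j\<close> through
        \<open>J\<close> into the dependence eliminates \<open>j\<close>. On the rows
        \<open>I\<close> a dependence among the columns \<open>J\<close> alone remains, so its
        coefficients \<open>d k + d j * c k\<close> vanish.\<close>
      have eq: "(\<Sum>k\<in>J. A $$ (l, k) * (d k + d j * c k)) 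
          = (\<Sum>k\<in>J. A $$ (l, k) * d k) + d j * (\<Sum>k\<in>J. A $$ (l, k) * c k)" for l
        by (simp add: algebra_simps sum.distrib sum_distrib_left)
      have z: "d k + d j * c k = 0" if "k \<in> J" for k
        by (rule independent_columnsD[OF ns _ that, of "\<lambda>k. d k + d j * c k"])
          (use eq c dsum in \<open>simp add: algebra_simps\<close>)
      \<comment> \<open>The eliminated relation now holds on row \<open>i\<close> too. Compared with
        the original dependence there, a nonzero \<open>d j\<close> would force \<open>c\<close> to
        reproduce column \<open>j\<close> on row \<open>i\<close>, against the choice of
        \<open>i\<close>.\<close>
      then have "(\<Sum>k\<in>J. A $$ (i, k) * d k) + d j * (\<Sum>k\<in>J. A $$ (i, k) * c k) = 0"
        using eq[of i] by simp
      moreover have "(\<Sum>k\<in>J. A $$ (i, k) * d k) + A $$ (i, j) * d j = 0"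
        using dsum[of i] by (simp add: add.commute)
      ultimately have "A $$ (i, j) * d j = d j * (\<Sum>k\<in>J. A $$ (i, k) * c k)"
        unfolding add_eq_0_iff by simp
      then have "d j = 0" using i(2) by simp
      then show "\<forall>k\<in>insert j J. d k = 0" using z by auto
    qed
    moreover have "card (insert i I) = card (insert j J)"
      using card iI j(2) finI finJ by simp
    ultimately show thesis
      using det_submatrix_nonzero_iff[of "insert i I" A "insert j J"] I J i(1) j(1) border[of i] iI
      by simp
  qed
qed

text \<open>The block grows one column at a time: a new column either lies in the span of the
  earlier ones, which independence forbids, or comes with a new row that keeps the determinant
  nonzero.\<close>

lemma independent_columns_nonzero_minor:
  fixes A :: "'a::field mat"
  assumes "J \<subseteq> {..<dim_col A}" and "independent_columns (\<lambda>i j. A $$ (i, j)) {..<dim_row A} J"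
  obtains I where "I \<subseteq> {..<dim_row A}" and "card I = card J" and "det (submatrix A I J) \<noteq> 0"
proof -
  have "finite J" using assms(1) finite_subset by blast
  then have "\<exists>I \<subseteq> {..<dim_row A}. card I = card J \<and> det (submatrix A I J) \<noteq> 0"
    using assms
  proof (induction J rule: finite_induct)
    case empty
    have "det (submatrix A {} {}) \<noteq> 0"
      using det_submatrix_nonzero_iff[of "{}" A "{}"] by (simp add: independent_columns_def)
    then show ?case by (intro exI[of _ "{}"]) auto
  next
    case (insert j J)
    have J: "J \<subseteq> {..<dim_col A}" and j: "j < dim_col A" using insert.prems by auto
    have "independent_columns (\<lambda>i j. A $$ (i, j)) {..<dim_row A} J"
      using independent_columns_subset[OF insert.prems(2)] insert.hyps(1) by auto
    then obtain I where I: "I \<subseteq> {..<dim_row A}" "card I = card J" "det (submatrix A I J) \<noteq> 0"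
      using insert.IH J by blast
    show ?case
    proof (rule column_in_span_or_border[OF I(1) J I(2,3) j insert.hyps(2)])
      fix c assume c: "\<And>i. i < dim_row A \<Longrightarrow> A $$ (i, j) = (\<Sum>k\<in>J. A $$ (i, k) * c k)"
      \<comment> \<open>The span relation with column \<open>j\<close> moved to the other side; its
        coefficient -1 at \<open>j\<close> contradicts independence.\<close>
      define d where "d = (\<lambda>k. if k = j then -1 else c k)"
      have "(\<Sum>k\<in>insert j J. A $$ (i, k) * d k) = 0" if "i \<in> {..<dim_row A}" for i
      proof -
        have "(\<Sum>k\<in>J. A $$ (i, k) * d k) = (\<Sum>k\<in>J. A $$ (i, k) * c k)"
          using insert.hyps(2) by (intro sum.cong) (auto simp: d_def)
        then show ?thesis using insert.hyps c that by (simp add: d_def)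
      qed
      from independent_columnsD[OF insert.prems(2) this, of j] have "d j = 0" by simp
      then show ?thesis by (simp add: d_def)
    next
      fix i assume "i < dim_row A" "i \<notin> I" "det (submatrix A (insert i I) (insert j J)) \<noteq> 0"
      moreover have "finite I" using I(1) finite_subset by blast
      ultimately show ?thesis
        using I(1,2) insert.hyps by (intro exI[of _ "insert i I"]) auto
    qed
  qed
  then show thesis using that by blast
qed

section \<open>Rank, column bases and bordered minors\<close>

text \<open>The rank is the size of a maximal independent subset of the set of columns. Passing from
  indices to vectors loses nothing on \<open>B\<close>, because two equal columns there would be a
  dependence with coefficients 1 and -1.\<close>

lemma rank_eq_card_basis:
  fixes A :: "'a::field mat"
  assumes A: "A \<in> carrier_mat nr nc" and B: "B \<subseteq> {..<nc}"
    and ind: "independent_columns (\<lambda>i j. A $$ (i, j)) {..<nr} B"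
    and span: "\<And>j. j < nc \<Longrightarrow> \<exists>c. \<forall>i<nr. A $$ (i, j) = (\<Sum>k\<in>B. A $$ (i, k) * c k)"
  shows "vec_space.rank nr A = card B"
proof -
  interpret vec_space "TYPE('a)" nr .
  have finB: "finite B" using B finite_subset by blast
  have inj: "inj_on (col A) B"
  proof (rule inj_onI, rule ccontr)
    fix j k assume jk: "j \<in> B" "k \<in> B" "col A j = col A k" "j \<noteq> k"
    then have "j < nc" "k < nc" using B by auto
    define c :: "nat \<Rightarrow> 'a" where "c = (\<lambda>l. if l = j then 1 else if l = k then - 1 else 0)"
    have "(\<Sum>l\<in>B. A $$ (i, l) * c l) = 0" if "i \<in> {..<nr}" for i
    proof -
      have "(\<Sum>l\<in>B. A $$ (i, l) * c l) = (\<Sum>l\<in>{j, k}. A $$ (i, l) * c l)"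
        using jk finB by (intro sum.mono_neutral_right) (auto simp: c_def)
      also have "\<dots> = col A j $ i - col A k $ i"
        using jk(4) that A \<open>j < nc\<close> \<open>k < nc\<close> by (auto simp: c_def)
      finally show ?thesis using jk by simp
    qed
    from independent_columnsD[OF ind this jk(1)] show False by (simp add: c_def)
  qed
  have setcols: "set (cols A) = col A ` {..<nc}"
    using A by (auto simp: cols_def)
  then have colsB: "col A ` B \<subseteq> set (cols A)" using B by auto
  have carr: "set (cols A) \<subseteq> carrier_vec nr" using A cols_dim by blast
  have comb: "lincomb a (col A ` B) $ i = (\<Sum>k\<in>B. A $$ (i, k) * a (col A k))" if "i < nr" for a i
  proof -
    have "lincomb a (col A ` B) $ i = (\<Sum>v\<in>col A ` B. a v * v $ i)"
      using lincomb_index[OF that, of "col A ` B"] colsB carr by auto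
    also have "\<dots> = (\<Sum>k\<in>B. A $$ (i, k) * a (col A k))"
      using inj A B that by (auto simp: sum.reindex intro!: sum.cong)
    finally show ?thesis .
  qed
  have "lin_indpt (col A ` B)"
  proof
    assume "lin_dep (col A ` B)"
    then obtain a v where a: "lincomb a (col A ` B) = 0\<^sub>v nr" "v \<in> col A ` B" "a v \<noteq> 0"
      using finite_lin_dep[of "col A ` B"] finB colsB carr by auto
    have "(\<Sum>k\<in>B. A $$ (i, k) * a (col A k)) = 0" if "i \<in> {..<nr}" for i
      using comb[of i a] a(1) that by simp
    from independent_columnsD[OF ind this] a(2,3) show False by auto
  qed
  moreover have "T = col A ` B"
    if T: "T \<supseteq> col A ` B" "T \<subseteq> set (cols A)" "lin_indpt T" for T
  proof (rule ccontr)
    assume "T \<noteq> col A ` B"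
    then obtain v where v: "v \<in> T" "v \<notin> col A ` B" using T(1) by blast
    then have "v \<in> col A ` {..<nc}" using T(2) unfolding setcols by blast
    with v obtain j where j: "j < nc" "col A j \<in> T" "col A j \<notin> col A ` B" by auto
    obtain c where c: "\<forall>i<nr. A $$ (i, j) = (\<Sum>k\<in>B. A $$ (i, k) * c k)" using span j by blast
    \<comment> \<open>Linear combinations of a set of vectors take coefficients on vectors, so
      \<open>c\<close> is transported along \<open>col A\<close>, which is injective on
      \<open>B\<close>. The value -1 at the extra column makes the combination vanish.\<close>
    define a where "a = (\<lambda>v. if v = col A j then - 1 else c (the_inv_into B (col A) v))"
    have "col A k \<noteq> col A j" if "k \<in> B" for k using j(3) that by (metis imageI)
    then have aj: "a (col A j) = - 1" and aB: "\<And>k. k \<in> B \<Longrightarrow> a (col A k) = c k"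
      using inj by (auto simp: a_def the_inv_into_f_f)
    have sub: "insert (col A j) (col A ` B) \<subseteq> carrier_vec nr" using T j carr by blast
    have zero: "lincomb a (insert (col A j) (col A ` B)) = 0\<^sub>v nr"
    proof (rule eq_vecI)
      show "dim_vec (lincomb a (insert (col A j) (col A ` B))) = dim_vec (0\<^sub>v nr)"
        using lincomb_dim[of "insert (col A j) (col A ` B)" a] sub finB by auto
      fix i assume "i < dim_vec (0\<^sub>v nr)"
      then have i: "i < nr" by simp
      have "lincomb a (insert (col A j) (col A ` B)) $ i
          = a (col A j) * col A j $ i + (\<Sum>v\<in>col A ` B. a v * v $ i)"
        unfolding lincomb_index[OF i sub] using finB j(3) by simp
      also have "(\<Sum>v\<in>col A ` B. a v * v $ i) = (\<Sum>k\<in>B. A $$ (i, k) * a (col A k))"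
        using comb[OF i, of a] lincomb_index[OF i, of "col A ` B" a] sub by auto
      also have "\<dots> = (\<Sum>k\<in>B. A $$ (i, k) * c k)" using aB by simp
      also have "\<dots> = A $$ (i, j)" using c i by simp
      finally show "lincomb a (insert (col A j) (col A ` B)) $ i = 0\<^sub>v nr $ i"
        using aj i j(1) A by simp
    qed
    have "lin_dep T"
      by (rule lin_dep_crit[where A = "insert (col A j) (col A ` B)" and a = a and v = "col A j"])
        (use zero finB T j aj in auto)
    then show False using T by simp
  qed
  ultimately have "maximal (col A ` B) (\<lambda>T. T \<subseteq> set (cols A) \<and> lin_indpt T)"
    unfolding maximal_def using colsB by blast
  from rank_card_indpt[OF A this] show ?thesis using inj by (simp add: card_image)
qed


text \<open>A maximal independent index set above \<open>J\<close> must span: by bordering, a column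
  outside its span would yield a larger independent set.\<close>

lemma basis_extension:
  fixes A :: "'a::field mat"
  assumes J: "J \<subseteq> {..<dim_col A}" and ind: "independent_columns (\<lambda>i j. A $$ (i, j)) {..<dim_row A} J"
  obtains B where "J \<subseteq> B" and "B \<subseteq> {..<dim_col A}"
    and "independent_columns (\<lambda>i j. A $$ (i, j)) {..<dim_row A} B"
    and "\<And>j. j < dim_col A \<Longrightarrow> \<exists>c. \<forall>i<dim_row A. A $$ (i, j) = (\<Sum>k\<in>B. A $$ (i, k) * c k)"
proof -
  let ?F = "{B. B \<subseteq> {..<dim_col A} \<and> independent_columns (\<lambda>i j. A $$ (i, j)) {..<dim_row A} B}"
  have "finite ?F" by simp
  from finite_has_maximal2[OF this, of J] J ind obtain B where
    B: "B \<in> ?F" "J \<subseteq> B" and max: "\<And>B'. B' \<in> ?F \<Longrightarrow> B \<subseteq> B' \<Longrightarrow> B = B'" by auto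
  have finB: "finite B" using B finite_subset by blast
  have "\<exists>c. \<forall>i<dim_row A. A $$ (i, j) = (\<Sum>k\<in>B. A $$ (i, k) * c k)" if j: "j < dim_col A" for j
  proof (cases "j \<in> B")
    case True
    then show ?thesis using finB by (intro exI[of _ "\<lambda>k. if k = j then 1 else 0"]) (auto simp: if_distrib cong: if_cong)
  next
    case False
    obtain I where I: "I \<subseteq> {..<dim_row A}" "card I = card B" "det (submatrix A I B) \<noteq> 0"
      using independent_columns_nonzero_minor B by blast
    show ?thesis
    proof (rule column_in_span_or_border[of I A B j])
      fix i assume i: "i < dim_row A" "i \<notin> I" "det (submatrix A (insert i I) (insert j B)) \<noteq> 0"
      have "card (insert i I) = card (insert j B)"
        using I i False finB by (simp add: finite_subset[OF I(1)])
      then have "independent_columns (\<lambda>i j. A $$ (i, j)) (insert i I) (insert j B)"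
        using det_submatrix_nonzero_iff[of "insert i I" A "insert j B"] I B i j by auto
      then have "independent_columns (\<lambda>i j. A $$ (i, j)) {..<dim_row A} (insert j B)"
        by (rule independent_columns_mono) (use I i in auto)
      then have "B = insert j B" using max[of "insert j B"] B j by auto
      then show ?thesis using False by auto
    qed (use I B j False in auto)
  qed
  then show thesis using that B by blast
qed

lemma minors_above_rank_vanish:
  assumes "A \<in> carrier_mat nr nc" and "m \<in> minors (vec_space.rank nr A + 1) A"
  shows "m = 0"
proof (rule ccontr)
  assume "m \<noteq> 0"
  obtain I J where IJ: "m = det (submatrix A I J)" "J \<subseteq> {..<dim_col A}" "card J = vec_space.rank nr A + 1"
    using assms(2) by (auto simp: minors_def)
  have "{j. j < nc \<and> j \<in> J} = J" using IJ(2) assms(1) by auto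
  then have "card J \<le> vec_space.rank nr A"
    using vec_space.rank_gt_minor[OF assms(1), of I J] \<open>m \<noteq> 0\<close> IJ(1) by simp
  then show False using IJ(3) by simp
qed

text \<open>A row at which bordering succeeds would exhibit a nonzero minor of size \<rho> + 1.
  Applied to the last column of an augmented matrix, this extends solvability from the rows
  \<open>I\<close> to all rows.\<close>

lemma column_in_span_of_block:
  fixes A :: "real mat"
  assumes I: "I \<subseteq> {..<dim_row A}" and B: "B \<subseteq> {..<dim_col A}" and card: "card I = \<rho>" "card B = \<rho>"
    and det: "det (submatrix A I B) \<noteq> 0" and minors: "\<forall>m\<in>minors (\<rho> + 1) A. m = 0"
    and j: "j < dim_col A"
  shows "\<exists>c. \<forall>i<dim_row A. A $$ (i, j) = (\<Sum>k\<in>B. A $$ (i, k) * c k)"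
proof (cases "j \<in> B")
  case True
  then show ?thesis using finite_subset[OF B]
    by (intro exI[of _ "\<lambda>k. if k = j then 1 else 0"]) (auto simp: if_distrib cong: if_cong)
next
  case False
  show ?thesis
  proof (rule column_in_span_or_border[of I A B j])
    fix i assume i: "i < dim_row A" "i \<notin> I" "det (submatrix A (insert i I) (insert j B)) \<noteq> 0"
    have "card (insert i I) = \<rho> + 1" "card (insert j B) = \<rho> + 1"
      using card i(2) False by (simp_all add: finite_subset[OF I] finite_subset[OF B])
    then have "det (submatrix A (insert i I) (insert j B)) \<in> minors (\<rho> + 1) A"
      unfolding minors_def using I B i(1) j by blast
    then show ?thesis using minors i(3) by blast
  qed (use I B card det j False in auto)
qed

text \<open>The nonzero block makes \<open>B\<close> independent and the vanishing of the larger
  minors makes it spanning. This is what identifies the strata as rank strata.\<close>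

lemma rank_eq_block_size:
  fixes A :: "real mat"
  assumes A: "A \<in> carrier_mat nr nc" and I: "I \<subseteq> {..<nr}" and B: "B \<subseteq> {..<nc}"
    and card: "card I = \<rho>" "card B = \<rho>"
    and det: "det (submatrix A I B) \<noteq> 0" and minors: "\<forall>m\<in>minors (\<rho> + 1) A. m = 0"
  shows "vec_space.rank nr A = \<rho>"
proof -
  have "independent_columns (\<lambda>i j. A $$ (i, j)) I B"
    using det_submatrix_nonzero_iff[of I A B] A I B card det by auto
  then have "independent_columns (\<lambda>i j. A $$ (i, j)) {..<nr} B"
    using independent_columns_mono I by blast
  then show ?thesis
    using rank_eq_card_basis[OF A B] column_in_span_of_block[of I A B \<rho>] A I B card det minors by auto
qed

section \<open>Nonnegative solutions of linear systems\<close>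

text \<open>Conic Caratheodory theorem, by induction on the size of the support; the empty support
  is independent vacuously.\<close>

lemma nonneg_solution_independent_support:
  fixes A :: "nat \<Rightarrow> nat \<Rightarrow> real"
  assumes "\<And>j. j < n \<Longrightarrow> P j \<ge> 0" and "\<And>i. i \<in> I \<Longrightarrow> (\<Sum>j<n. A i j * P j) = b i"
  obtains Q where "\<And>j. j < n \<Longrightarrow> Q j \<ge> 0" and "\<And>i. i \<in> I \<Longrightarrow> (\<Sum>j<n. A i j * Q j) = b i"
    and "independent_columns A I {j. j < n \<and> Q j \<noteq> 0}"
proof -
  have "\<exists>Q. (\<forall>j<n. Q j \<ge> 0) \<and> (\<forall>i\<in>I. (\<Sum>j<n. A i j * Q j) = b i)
          \<and> independent_columns A I {j. j < n \<and> Q j \<noteq> 0}"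
    using assms
  proof (induction "card {j. j < n \<and> P j \<noteq> 0}" arbitrary: P rule: less_induct)
    case less
    let ?J = "{j. j < n \<and> P j \<noteq> 0}"
    show ?case
    proof (cases "independent_columns A I ?J")
      case True
      then show ?thesis using less.prems by blast
    next
      case False
      then obtain d j where d: "\<forall>i\<in>I. (\<Sum>k\<in>?J. A i k * d k) = 0" "j \<in> ?J" "d j \<noteq> 0"
        unfolding independent_columns_def by blast
      txt \<open>Moving along the dependence, with its sign chosen so that some entry of \<open>P\<close> decreases, until
        the first entry hits zero shrinks the support.\<close>
      define c where "c = (\<lambda>k. if k \<in> ?J then sgn (d j) * d k else 0)"
      have cj: "c j > 0" using d by (simp add: c_def sgn_mult_self_eq mult_sgn_abs[symmetric] sgn_if)
      have csum: "(\<Sum>k<n. A i k * c k) = 0" if "i \<in> I" for i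
      proof -
        have "(\<Sum>k<n. A i k * c k) = (\<Sum>k\<in>?J. sgn (d j) * (A i k * d k))"
          by (intro sum.mono_neutral_cong_right) (auto simp: c_def)
        also have "\<dots> = 0" using d(1) that by (simp flip: sum_distrib_left)
        finally show ?thesis .
      qed
      let ?K = "{k. k < n \<and> c k > 0}"
      \<comment> \<open>The ratio test of linear programming: only indices with
        \<open>c k > 0\<close> limit the step, and \<open>j\<close> is one of them.\<close>
      define t where "t = Min ((\<lambda>k. P k / c k) ` ?K)"
      have K: "finite ?K" "?K \<noteq> {}" using cj d(2) by auto
      then have "t \<in> (\<lambda>k. P k / c k) ` ?K" unfolding t_def by (intro Min_in) auto
      then obtain m where m: "m < n" "c m > 0" "t = P m / c m" by auto
      have t0: "t \<ge> 0" using m less.prems(1) by simp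
      have tle: "t \<le> P k / c k" if "k \<in> ?K" for k unfolding t_def using K that by simp
      define Q where "Q = (\<lambda>k. P k - t * c k)"
      have Q0: "Q k \<ge> 0" if "k < n" for k
      proof (cases "c k > 0")
        case True
        then show ?thesis using tle[of k] that by (simp add: Q_def field_simps)
      next
        case False
        then have "t * c k \<le> 0" using t0 by (simp add: mult_nonneg_nonpos)
        then show ?thesis using less.prems(1)[OF that] by (simp add: Q_def)
      qed
      have Qsum: "(\<Sum>k<n. A i k * Q k) = b i" if "i \<in> I" for i
      proof -
        have "(\<Sum>k<n. A i k * Q k) = (\<Sum>k<n. A i k * P k) - t * (\<Sum>k<n. A i k * c k)"
          by (simp add: Q_def algebra_simps sum_subtractf sum_distrib_left)
        then show ?thesis using less.prems(2) csum that by simp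
      qed
      \<comment> \<open>Off the support both \<open>P\<close> and \<open>c\<close> are zero, so no
        new entry appears, while the minimising index \<open>m\<close> drops out.\<close>
      have "{j. j < n \<and> Q j \<noteq> 0} \<subseteq> ?J" by (auto simp: Q_def c_def)
      moreover have "m \<in> ?J" "Q m = 0" using m by (auto simp: Q_def c_def split: if_splits)
      ultimately have "card {j. j < n \<and> Q j \<noteq> 0} < card ?J"
        by (intro psubset_card_mono) auto
      from less.hyps[OF this Q0 Qsum] show ?thesis by blast
    qed
  qed
  then show thesis using that by blast
qed

section \<open>Augmented systems and certificates from Cramer's rule\<close>

lemma augmented_mat_carrier:
  "A \<in> carrier_mat nr nc \<Longrightarrow> augmented_mat A b \<in> carrier_mat nr (nc + 1)"
  by (rule carrier_matI) (simp_all add: augmented_mat_def carrier_matD)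

lemma index_augmented_mat:
  assumes "A \<in> carrier_mat nr nc" and "i < nr" and "j < nc + 1"
  shows "augmented_mat A b $$ (i, j) = (if j < nc then A $$ (i, j) else b $ i)"
  using assms by (auto simp: augmented_mat_def mat_of_cols_index nth_append)

text \<open>As \<open>B\<close> avoids the adjoined column, the nonzero block of \<open>A\<close>
  also serves as the block to be bordered in the augmented matrix.\<close>

lemma submatrix_augmented_mat:
  assumes A: "A \<in> carrier_mat nr nc" and I: "I \<subseteq> {..<nr}" and B: "B \<subseteq> {..<nc}"
  shows "submatrix (augmented_mat A b) I B = submatrix A I B"
proof -
  have dims: "dim_row (augmented_mat A b) = nr" "dim_col (augmented_mat A b) = nc + 1"
    using augmented_mat_carrier[OF A, of b] by auto
  have "pick I i < nr" if "i < card I" for i using pick_in_set_le[OF that] I by auto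
  moreover have "pick B j < nc" if "j < card B" for j using pick_in_set_le[OF that] B by auto
  moreover have "{j. j < Suc nc \<and> j \<in> B} = B" using B by auto
  moreover have "dim_row A = nr" "dim_col A = nc" using A by auto
  ultimately show ?thesis
    using dims I B unfolding submatrix_def
    by (intro cong_mat) (simp_all add: set_of_less index_augmented_mat[OF A] less_SucI)
qed

text \<open>The conditions of \<open>stratum\<close> for an arbitrary system, detached from the
  decision process, so that both inclusions become statements of linear algebra.\<close>

definition cramer_certificate :: "real mat \<Rightarrow> real vec \<Rightarrow> nat \<Rightarrow> nat set \<Rightarrow> nat set \<Rightarrow> bool" where
  "cramer_certificate A b \<rho> I B \<longleftrightarrow>
     det (submatrix A I B) \<noteq> 0 \<and>
     (\<forall>m\<in>minors (\<rho> + 1) A. m = 0) \<and> (\<forall>m\<in>minors (\<rho> + 1) (augmented_mat A b). m = 0) \<and>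
     (\<forall>t<\<rho>. det (replace_col (submatrix A I B) (subvector b I) t) * det (submatrix A I B) \<ge> 0)"

text \<open>Here \<open>t\<close> is a position in the block and \<open>pick B t\<close> the column
  it stands for. Any coefficients solving the rows \<open>I\<close> are allowed, so that the lemma
  serves both directions: the Caratheodory solution and the one found by bordering.\<close>

lemma cramer_submatrix:
  fixes A :: "'a::field mat"
  assumes A: "A \<in> carrier_mat nr nc" and b: "b \<in> carrier_vec nr"
    and I: "I \<subseteq> {..<nr}" and B: "B \<subseteq> {..<nc}" and card: "card I = card B"
    and sol: "\<And>i. i \<in> I \<Longrightarrow> (\<Sum>k\<in>B. A $$ (i, k) * c k) = b $ i" and t: "t < card B"
  shows "det (replace_col (submatrix A I B) (subvector b I) t) = c (pick B t) * det (submatrix A I B)"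
proof -
  have I': "I \<subseteq> {..<dim_row A}" and B': "B \<subseteq> {..<dim_col A}" and Ib: "I \<subseteq> {..<dim_vec b}"
    using A I B b by auto
  have carr: "submatrix A I B \<in> carrier_mat (card B) (card B)"
    using submatrix_carrier[OF I' B'] card by simp
  let ?p = "vec (card B) (\<lambda>j. c (pick B j))"
  have "submatrix A I B *\<^sub>v ?p = subvector b I"
  proof (rule eq_vecI)
    show "dim_vec (submatrix A I B *\<^sub>v ?p) = dim_vec (subvector b I)"
      using carr card dim_subvector[OF Ib] by simp
    fix i assume "i < dim_vec (subvector b I)"
    then have i: "i < card I" using dim_subvector[OF Ib] by simp
    show "(submatrix A I B *\<^sub>v ?p) $ i = subvector b I $ i"
      using index_submatrix_mult_vec[OF I' B' i, of c] index_subvector[OF Ib i]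
        sol[OF pick_in_set_le[OF i]] by simp
  qed
  then show ?thesis using cramer_lemma_mat[OF carr, of ?p t] t by simp
qed

lemma cramer_certificate_exists:
  fixes A :: "real mat"
  assumes A: "A \<in> carrier_mat nr nc" and b: "b \<in> carrier_vec nr" and b0: "b \<noteq> 0\<^sub>v nr"
    and P: "P \<in> carrier_vec nc" and eq: "A *\<^sub>v P = b" and nonneg: "P \<ge> 0\<^sub>v nc"
  obtains \<rho> I B where "\<rho> \<in> {1..nr}" and "I \<subseteq> {..<nr}" and "card I = \<rho>"
    and "B \<subseteq> {..<nc}" and "card B = \<rho>" and "cramer_certificate A b \<rho> I B"
proof -
  have sumP: "(\<Sum>j<nc. A $$ (i, j) * P $ j) = b $ i" if "i \<in> {..<nr}" for i
    using eq that A P by (auto simp: scalar_prod_def lessThan_atLeast0)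
  have P0: "P $ j \<ge> 0" if "j < nc" for j
    using nonneg that P by (auto simp: less_eq_vec_def)
  obtain Q where Q0: "\<And>j. j < nc \<Longrightarrow> Q j \<ge> 0"
    and Qsum: "\<And>i. i \<in> {..<nr} \<Longrightarrow> (\<Sum>j<nc. A $$ (i, j) * Q j) = b $ i"
    and Qind: "independent_columns (\<lambda>i j. A $$ (i, j)) {..<nr} {j. j < nc \<and> Q j \<noteq> 0}"
    using nonneg_solution_independent_support[of nc "\<lambda>j. P $ j" "{..<nr}" "\<lambda>i j. A $$ (i, j)" "\<lambda>i. b $ i"]
      P0 sumP by blast
  obtain B where JB: "{j. j < nc \<and> Q j \<noteq> 0} \<subseteq> B" and B: "B \<subseteq> {..<nc}"
    and ind: "independent_columns (\<lambda>i j. A $$ (i, j)) {..<nr} B"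
    and span: "\<And>j. j < nc \<Longrightarrow> \<exists>c. \<forall>i<nr. A $$ (i, j) = (\<Sum>k\<in>B. A $$ (i, k) * c k)"
    using basis_extension[of "{j. j < nc \<and> Q j \<noteq> 0}" A] Qind A by auto
  have finB: "finite B" using B finite_subset by blast
  have QB: "(\<Sum>k\<in>B. A $$ (i, k) * Q k) = b $ i" if "i < nr" for i
    using Qsum[of i] that JB B sum.mono_neutral_left[of "{..<nc}" B "\<lambda>k. A $$ (i, k) * Q k"] by auto
  obtain I where I: "I \<subseteq> {..<nr}" "card I = card B" "det (submatrix A I B) \<noteq> 0"
    using independent_columns_nonzero_minor[of B A] B ind A by auto
  have Ab: "augmented_mat A b \<in> carrier_mat nr (nc + 1)" by (rule augmented_mat_carrier[OF A])
  have "vec_space.rank nr A = card B" by (rule rank_eq_card_basis[OF A B ind span])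
  then have minors: "\<forall>m\<in>minors (card B + 1) A. m = 0"
    using minors_above_rank_vanish[OF A] by simp
  \<comment> \<open>By \<open>Q\<close> the right-hand side already lies in the span of the columns
    \<open>B\<close>, so adjoining it does not raise the rank.\<close>
  have "vec_space.rank nr (augmented_mat A b) = card B"
  proof (rule rank_eq_card_basis[OF Ab])
    show "B \<subseteq> {..<nc + 1}" using B by auto
    have eqAb: "augmented_mat A b $$ (i, k) = A $$ (i, k)" if "i < nr" "k \<in> B" for i k
      using that B index_augmented_mat[OF A, of i k b] by auto
    then have sumAb: "(\<Sum>k\<in>B. augmented_mat A b $$ (i, k) * c k) = (\<Sum>k\<in>B. A $$ (i, k) * c k)"
      if "i < nr" for i c using that by simp
    show "independent_columns (\<lambda>i j. augmented_mat A b $$ (i, j)) {..<nr} B"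
      using ind sumAb by (simp add: independent_columns_def)
    fix j assume j: "j < nc + 1"
    show "\<exists>c. \<forall>i<nr. augmented_mat A b $$ (i, j) = (\<Sum>k\<in>B. augmented_mat A b $$ (i, k) * c k)"
    proof (cases "j < nc")
      case True
      then show ?thesis using span[OF True] sumAb index_augmented_mat[OF A, of _ j b] by auto
    next
      case False
      then show ?thesis using j QB sumAb index_augmented_mat[OF A, of _ j b] by (intro exI[of _ Q]) auto
    qed
  qed
  then have minors': "\<forall>m\<in>minors (card B + 1) (augmented_mat A b). m = 0"
    using minors_above_rank_vanish[OF Ab] by simp
  have "det (replace_col (submatrix A I B) (subvector b I) t) * det (submatrix A I B) \<ge> 0"
    if t: "t < card B" for t
  proof -
    have "pick B t < nc" using pick_in_set_le[OF t] B by auto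
    moreover have "det (replace_col (submatrix A I B) (subvector b I) t) = Q (pick B t) * det (submatrix A I B)"
      by (rule cramer_submatrix[OF A b I(1) B I(2) _ t]) (use QB I(1) in auto)
    ultimately show ?thesis using Q0 by (simp add: mult.assoc)
  qed
  then have "cramer_certificate A b (card B) I B"
    unfolding cramer_certificate_def using I(3) minors minors' by blast
  \<comment> \<open>An empty basis would leave only the zero combination, that is
    \<open>b = 0\<close>.\<close>
  moreover have "card B \<ge> 1"
  proof (rule ccontr)
    assume "\<not> card B \<ge> 1"
    then have "B = {}" using finB by (simp add: not_less_eq_eq)
    then have "b = 0\<^sub>v nr" using QB b by (intro eq_vecI) auto
    then show False using b0 by simp
  qed
  moreover have "card B \<le> nr" using I(1,2) by (metis card_lessThan card_mono finite_lessThan)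
  ultimately show thesis using that[of "card B" I B] I B by simp
qed

text \<open>Bordering expresses the last column of the augmented matrix, at index \<open>nc\<close>
  and equal to \<open>b\<close>, through the columns \<open>B\<close> on every row. Extended by
  zero, these coefficients are the solution, and Cramer's rule reads their signs off the
  certificate.\<close>

lemma cramer_certificate_nonneg_solution:
  fixes A :: "real mat"
  assumes A: "A \<in> carrier_mat nr nc" and b: "b \<in> carrier_vec nr"
    and I: "I \<subseteq> {..<nr}" "card I = \<rho>" and B: "B \<subseteq> {..<nc}" "card B = \<rho>"
    and cert: "cramer_certificate A b \<rho> I B"
  obtains P where "P \<in> carrier_vec nc" and "A *\<^sub>v P = b" and "P \<ge> 0\<^sub>v nc"
proof -
  have det: "det (submatrix A I B) \<noteq> 0" using cert by (simp add: cramer_certificate_def)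
  have finB: "finite B" using B(1) finite_subset by blast
  have Ab: "augmented_mat A b \<in> carrier_mat nr (nc + 1)" by (rule augmented_mat_carrier[OF A])
  have "\<exists>c. \<forall>i<dim_row (augmented_mat A b).
      augmented_mat A b $$ (i, nc) = (\<Sum>k\<in>B. augmented_mat A b $$ (i, k) * c k)"
  proof (rule column_in_span_of_block)
    show "det (submatrix (augmented_mat A b) I B) \<noteq> 0"
      using det submatrix_augmented_mat[OF A I(1) B(1)] by simp
    show "\<forall>m\<in>minors (\<rho> + 1) (augmented_mat A b). m = 0"
      using cert by (simp add: cramer_certificate_def)
  qed (use Ab I B in auto)
  then obtain c where c: "\<And>i. i < nr \<Longrightarrow>
      augmented_mat A b $$ (i, nc) = (\<Sum>k\<in>B. augmented_mat A b $$ (i, k) * c k)"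
    using Ab by auto
  have cB: "(\<Sum>k\<in>B. A $$ (i, k) * c k) = b $ i" if i: "i < nr" for i
  proof -
    have "(\<Sum>k\<in>B. A $$ (i, k) * c k) = (\<Sum>k\<in>B. augmented_mat A b $$ (i, k) * c k)"
      using B(1) i by (intro sum.cong) (auto simp: index_augmented_mat[OF A])
    then show ?thesis using c[OF i] index_augmented_mat[OF A i, of nc b] by simp
  qed
  have c0: "c k \<ge> 0" if "k \<in> B" for k
  proof -
    have "k \<in> pick B ` {..<card B}"
      using that bij_betw_imp_surj_on[OF bij_betw_pick[OF finB]] by simp
    then obtain t where t: "t < card B" "k = pick B t" by auto
    let ?D = "det (submatrix A I B)"
    have "det (replace_col (submatrix A I B) (subvector b I) t) = c (pick B t) * ?D"
      by (rule cramer_submatrix[OF A b I(1) B(1) _ _ t(1)]) (use I B cB in auto)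
    \<comment> \<open>The product in the sign condition is \<open>c k\<close> times a positive
      square, so its sign is that of \<open>c k\<close>.\<close>
    then have "c k * (?D * ?D) \<ge> 0"
      using cert t B(2) by (auto simp: cramer_certificate_def mult.assoc)
    moreover have "?D * ?D > 0" using det by (metis not_real_square_gt_zero)
    ultimately show ?thesis by (simp add: zero_le_mult_iff)
  qed
  let ?P = "vec nc (\<lambda>j. if j \<in> B then c j else 0)"
  have "(\<Sum>j<nc. A $$ (i, j) * (if j \<in> B then c j else 0)) = b $ i" if "i < nr" for i
  proof -
    have "(\<Sum>j<nc. A $$ (i, j) * (if j \<in> B then c j else 0)) = (\<Sum>k\<in>B. A $$ (i, k) * c k)"
      using B(1) by (intro sum.mono_neutral_cong_right) auto
    then show ?thesis using cB that by simp
  qed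
  then have "A *\<^sub>v ?P = b"
    using A b by (intro eq_vecI) (auto simp: scalar_prod_def lessThan_atLeast0 row_def)
  moreover have "?P \<ge> 0\<^sub>v nc" using c0 by (auto simp: less_eq_vec_def)
  ultimately show thesis using that[of ?P] by simp
qed


section \<open>Semialgebraicity\<close>

lemma semialgebraic_UNIV: "semialgebraic UNIV"
  using semialgebraic.zero[of "\<lambda>_. 0"] by auto

lemma semialgebraic_nonzero: "real_polynomial_function p \<Longrightarrow> semialgebraic {x. p x \<noteq> 0}"
  using semialgebraic.compl[OF semialgebraic.zero] by (simp add: Collect_neg_eq)

lemma semialgebraic_nonneg:
  assumes "real_polynomial_function p"
  shows "semialgebraic {x. p x \<ge> 0}"
proof -
  have "{x. p x \<ge> 0} = - {x. - p x > 0}" by auto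
  then show ?thesis
    using semialgebraic.compl[OF semialgebraic.pos[OF real_polynomial_function_minus[OF assms]]] by simp
qed

lemma semialgebraic_Ball:
  assumes "finite K" and "\<And>k. k \<in> K \<Longrightarrow> semialgebraic {x. P k x}"
  shows "semialgebraic {x. \<forall>k\<in>K. P k x}"
  using assms
proof (induction K rule: finite_induct)
  case empty
  then show ?case using semialgebraic_UNIV by simp
next
  case (insert k K)
  have "{x. \<forall>l\<in>insert k K. P l x} = {x. P k x} \<inter> {x. \<forall>l\<in>K. P l x}" by auto
  then show ?case using insert by (simp add: semialgebraic.inter)
qed

section \<open>Matrices with polynomial entries\<close>

definition polynomial_mat :: "('b::real_normed_vector \<Rightarrow> real mat) \<Rightarrow> nat \<Rightarrow> nat \<Rightarrow> bool" where
  "polynomial_mat A nr nc \<longleftrightarrow> (\<forall>x. A x \<in> carrier_mat nr nc) \<and>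
     (\<forall>i<nr. \<forall>j<nc. real_polynomial_function (\<lambda>x. A x $$ (i, j)))"

lemma polynomial_mat_carrier: "polynomial_mat A nr nc \<Longrightarrow> A x \<in> carrier_mat nr nc"
  by (simp add: polynomial_mat_def)

lemma polynomial_mat_index:
  "polynomial_mat A nr nc \<Longrightarrow> i < nr \<Longrightarrow> j < nc \<Longrightarrow> real_polynomial_function (\<lambda>x. A x $$ (i, j))"
  by (simp add: polynomial_mat_def)

text \<open>The Leibniz formula runs over permutations of a set that does not depend on
  \<open>x\<close>, because \<open>polynomial_mat\<close> fixes the dimensions.\<close>

lemma polynomial_det:
  assumes "polynomial_mat A n n"
  shows "real_polynomial_function (\<lambda>x. det (A x))"
  unfolding det_def'[OF polynomial_mat_carrier[OF assms]]
proof (intro real_polynomial_function_sum real_polynomial_function.intros(4) real_polynomial_function.intros(2)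
    real_polynomial_function_prod finite_permutations finite_atLeastLessThan)
  fix p i assume p: "p \<in> {p. p permutes {0..<n}}" and i: "i \<in> {0..<n}"
  then have "p i < n" using permutes_in_image[of p "{0..<n}" i] by simp
  then show "real_polynomial_function (\<lambda>x. A x $$ (i, p i))"
    using polynomial_mat_index[OF assms] i by simp
qed

lemma polynomial_submatrix:
  assumes A: "polynomial_mat A nr nc" and I: "I \<subseteq> {..<nr}" and J: "J \<subseteq> {..<nc}"
  shows "polynomial_mat (\<lambda>x. submatrix (A x) I J) (card I) (card J)"
  unfolding polynomial_mat_def
proof (intro conjI allI impI)
  have I': "I \<subseteq> {..<dim_row (A x)}" and J': "J \<subseteq> {..<dim_col (A x)}" for x
    using polynomial_mat_carrier[OF A, of x] I J by auto
  show "submatrix (A x) I J \<in> carrier_mat (card I) (card J)" for x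
    by (rule submatrix_carrier[OF I' J'])
  fix i j assume ij: "i < card I" "j < card J"
  then have "pick I i < nr" "pick J j < nc" using pick_in_set_le I J by auto
  then show "real_polynomial_function (\<lambda>x. submatrix (A x) I J $$ (i, j))"
    using polynomial_mat_index[OF A] by (simp add: index_submatrix[OF I' J' ij])
qed

lemma polynomial_replace_col:
  assumes A: "polynomial_mat A nr nc"
    and v: "\<And>i. i < nr \<Longrightarrow> real_polynomial_function (\<lambda>x. v x $ i)"
  shows "polynomial_mat (\<lambda>x. replace_col (A x) (v x) t) nr nc"
  unfolding polynomial_mat_def
proof (intro conjI allI impI)
  have dims: "dim_row (A x) = nr" "dim_col (A x) = nc" for x
    using polynomial_mat_carrier[OF A, of x] by auto
  show "replace_col (A x) (v x) t \<in> carrier_mat nr nc" for x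
    by (simp add: replace_col_def dims)
  fix i j assume "i < nr" "j < nc"
  then show "real_polynomial_function (\<lambda>x. replace_col (A x) (v x) t $$ (i, j))"
    using v polynomial_mat_index[OF A] by (cases "j = t") (simp_all add: replace_col_def dims)
qed

lemma polynomial_augmented_mat:
  assumes A: "polynomial_mat A nr nc"
    and b: "\<And>i. i < nr \<Longrightarrow> real_polynomial_function (\<lambda>x. b x $ i)"
  shows "polynomial_mat (\<lambda>x. augmented_mat (A x) (b x)) nr (nc + 1)"
  unfolding polynomial_mat_def
proof (intro conjI allI impI)
  note carr = polynomial_mat_carrier[OF A]
  show "augmented_mat (A x) (b x) \<in> carrier_mat nr (nc + 1)" for x
    by (rule augmented_mat_carrier[OF carr])
  fix i j assume ij: "i < nr" "j < nc + 1"
  show "real_polynomial_function (\<lambda>x. augmented_mat (A x) (b x) $$ (i, j))"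
    using b[OF ij(1)] polynomial_mat_index[OF A ij(1), of j]
    by (cases "j < nc") (simp_all add: index_augmented_mat[OF carr ij])
qed

text \<open>The set of minors varies with \<open>x\<close>, so the finite intersection is taken over
  pairs of index sets, which do not.\<close>

lemma semialgebraic_minors_vanish:
  fixes A :: "real ^ 'n \<Rightarrow> real mat"
  assumes A: "polynomial_mat A nr nc"
  shows "semialgebraic {x. \<forall>m\<in>minors k (A x). m = 0}"
proof -
  let ?K = "{(I, J). I \<subseteq> {..<nr} \<and> J \<subseteq> {..<nc} \<and> card I = k \<and> card J = k}"
  have dims: "dim_row (A x) = nr" "dim_col (A x) = nc" for x
    using polynomial_mat_carrier[OF A, of x] by auto
  have fin: "finite ?K"
    by (rule finite_subset[of _ "Pow {..<nr} \<times> Pow {..<nc}"]) auto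
  have "semialgebraic {x. \<forall>K\<in>?K. det (submatrix (A x) (fst K) (snd K)) = 0}"
  proof (rule semialgebraic_Ball[OF fin])
    fix K assume "K \<in> ?K"
    then have K: "fst K \<subseteq> {..<nr}" "snd K \<subseteq> {..<nc}" "card (fst K) = k" "card (snd K) = k" by auto
    show "semialgebraic {x. det (submatrix (A x) (fst K) (snd K)) = 0}"
      by (intro semialgebraic.zero polynomial_det)
        (use polynomial_submatrix[OF A K(1,2)] K(3,4) in simp)
  qed
  moreover have "{x. \<forall>K\<in>?K. det (submatrix (A x) (fst K) (snd K)) = 0}
      = {x. \<forall>m\<in>minors k (A x). m = 0}"
    by (auto simp: minors_def dims)
  ultimately show ?thesis by simp
qed

lemma semialgebraic_cramer_certificate:
  fixes A :: "real ^ 'n \<Rightarrow> real mat"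
  assumes A: "polynomial_mat A nr nc" and b: "\<And>x. b x \<in> carrier_vec nr"
    and pb: "\<And>i. i < nr \<Longrightarrow> real_polynomial_function (\<lambda>x. b x $ i)"
    and I: "I \<subseteq> {..<nr}" "card I = \<rho>" and B: "B \<subseteq> {..<nc}" "card B = \<rho>"
  shows "semialgebraic {x. cramer_certificate (A x) (b x) \<rho> I B}"
proof -
  have sub: "polynomial_mat (\<lambda>x. submatrix (A x) I B) \<rho> \<rho>"
    using polynomial_submatrix[OF A I(1) B(1)] I B by simp
  have "real_polynomial_function (\<lambda>x. subvector (b x) I $ i)" if i: "i < \<rho>" for i
  proof -
    have "I \<subseteq> {..<dim_vec (b x)}" for x using b[of x] I by auto
    moreover have "pick I i < nr" using pick_in_set_le[of i I] i I by auto
    ultimately show ?thesis using pb i I by (simp add: index_subvector)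
  qed
  then have "polynomial_mat (\<lambda>x. replace_col (submatrix (A x) I B) (subvector (b x) I) t) \<rho> \<rho>" for t
    by (rule polynomial_replace_col[OF sub])
  note polys = polynomial_det[OF this] polynomial_det[OF sub]
  have "{x. cramer_certificate (A x) (b x) \<rho> I B} =
      {x. det (submatrix (A x) I B) \<noteq> 0} \<inter> {x. \<forall>m\<in>minors (\<rho> + 1) (A x). m = 0} \<inter>
      {x. \<forall>m\<in>minors (\<rho> + 1) (augmented_mat (A x) (b x)). m = 0} \<inter>
      {x. \<forall>t\<in>{..<\<rho>}. det (replace_col (submatrix (A x) I B) (subvector (b x) I) t)
          * det (submatrix (A x) I B) \<ge> 0}"
    unfolding cramer_certificate_def by auto
  also have "semialgebraic \<dots>"
    by (intro semialgebraic.inter semialgebraic_nonzero semialgebraic_minors_vanish[OF A]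
        semialgebraic_minors_vanish[OF polynomial_augmented_mat[OF A pb]] semialgebraic_Ball
        semialgebraic_nonneg real_polynomial_function.intros(4) polys finite_lessThan)
  finally show ?thesis .
qed

section \<open>Feasible value functions\<close>

lemma C_mat_carrier:
  "C_mat \<alpha> \<beta> r \<gamma> Ss Os As x \<in> carrier_mat (length Ss + length Os) (length Os * length As)"
  unfolding C_mat_def
  by (rule carrier_append_rows; rule carrier_matI) (simp_all add: M_mat_def R_mat_def)

lemma index_C_mat:
  assumes i: "i < length Ss + length Os" and j: "j < length Os * length As"
  shows "C_mat \<alpha> \<beta> r \<gamma> Ss Os As x $$ (i, j) =
    (let (w, a) = List.product Os As ! j in
       if i < length Ss then u_vec \<alpha> \<beta> r \<gamma> x w a $h (Ss ! i)
       else if w = Os ! (i - length Ss) then 1 else 0)"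
  using assms
  by (auto simp: C_mat_def append_rows_def M_mat_def R_mat_def mat_of_cols_index coord_vec_def
      split: prod.splits)

lemma f_vec_carrier: "f_vec Ss Os x \<in> carrier_vec (length Ss + length Os)"
  by (rule carrier_vecI) (simp add: f_vec_def coord_vec_def)

lemma index_f_vec:
  "i < length Ss + length Os \<Longrightarrow> f_vec Ss Os x $ i = (if i < length Ss then x $h (Ss ! i) else 1)"
  by (auto simp: f_vec_def coord_vec_def)

lemma polynomial_vec_nth: "real_polynomial_function (\<lambda>x::real ^ 'n. x $h s)"
  by (intro real_polynomial_function.intros(1) bounded_linear_vec_nth)

text \<open>Entries in the state rows are affine in \<open>x\<close>; those in the observation rows
  are constant.\<close>

lemma polynomial_C_mat:
  "polynomial_mat (C_mat \<alpha> \<beta> r \<gamma> Ss Os As) (length Ss + length Os) (length Os * length As)"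
  unfolding polynomial_mat_def
proof (intro conjI allI impI C_mat_carrier)
  fix i j assume ij: "i < length Ss + length Os" "j < length Os * length As"
  obtain w a where wa: "List.product Os As ! j = (w, a)" by fastforce
  have "real_polynomial_function (\<lambda>x. u_vec \<alpha> \<beta> r \<gamma> x w a $h s)" for s
    unfolding u_vec_def
    by (auto intro!: real_polynomial_function.intros(4) real_polynomial_function.intros(3)
        real_polynomial_function.intros(2) real_polynomial_function_sum polynomial_vec_nth)
  then show "real_polynomial_function (\<lambda>x. C_mat \<alpha> \<beta> r \<gamma> Ss Os As x $$ (i, j))"
    by (cases "i < length Ss") (simp_all add: index_C_mat[OF ij] wa real_polynomial_function.intros(2))
qed

lemma polynomial_f_vec:
  "i < length Ss + length Os \<Longrightarrow> real_polynomial_function (\<lambda>x. f_vec Ss Os x $ i)"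
  by (cases "i < length Ss") (simp_all add: index_f_vec polynomial_vec_nth real_polynomial_function.intros(2))

text \<open>The policy enters the transition matrix and the reward linearly through
  \<open>effective_policy\<close>. Expanding it and exchanging the sums over observations and
  actions leaves \<open>u_vec\<close> as the coefficient of each \<open>\<pi> w a\<close>.\<close>

lemma bellman_equation_iff:
  "(Finite_Cartesian_Product.mat 1 - \<gamma> *\<^sub>R policy_transition \<alpha> \<beta> \<pi>) *v x = policy_reward \<beta> r \<pi> \<longleftrightarrow>
     (\<forall>s. (\<Sum>w\<in>UNIV. \<Sum>a\<in>UNIV. u_vec \<alpha> \<beta> r \<gamma> x w a $h s * \<pi> w a) = x $h s)"
proof -
  have "(\<Sum>w\<in>UNIV. \<Sum>a\<in>UNIV. u_vec \<alpha> \<beta> r \<gamma> x w a $h s * \<pi> w a)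
      = \<gamma> * (policy_transition \<alpha> \<beta> \<pi> *v x) $h s + policy_reward \<beta> r \<pi> $h s" for s
  proof -
    have "(\<Sum>w\<in>UNIV. \<Sum>a\<in>UNIV. u_vec \<alpha> \<beta> r \<gamma> x w a $h s * \<pi> w a)
        = (\<Sum>a\<in>UNIV. effective_policy \<beta> \<pi> s a * (\<gamma> * (\<Sum>s'\<in>UNIV. \<alpha> s a s' * x $h s') + r s a))"
      by (subst sum.swap) (simp add: u_vec_def effective_policy_def sum_distrib_right mult_ac)
    also have "\<dots> = \<gamma> * (\<Sum>a\<in>UNIV. \<Sum>s'\<in>UNIV. effective_policy \<beta> \<pi> s a * \<alpha> s a s' * x $h s')
        + policy_reward \<beta> r \<pi> $h s"
      by (simp add: policy_reward_def distrib_left sum.distrib sum_distrib_left mult_ac)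
    also have "(\<Sum>a\<in>UNIV. \<Sum>s'\<in>UNIV. effective_policy \<beta> \<pi> s a * \<alpha> s a s' * x $h s')
        = (policy_transition \<alpha> \<beta> \<pi> *v x) $h s"
      by (subst sum.swap) (simp add: policy_transition_def matrix_vector_mult_def sum_distrib_right)
    finally show ?thesis .
  qed
  moreover have "(Finite_Cartesian_Product.mat 1 - \<gamma> *\<^sub>R policy_transition \<alpha> \<beta> \<pi>) *v x
      = x - \<gamma> *\<^sub>R (policy_transition \<alpha> \<beta> \<pi> *v x)"
    by (simp add: matrix_vector_mult_diff_rdistrib scaleR_matrix_vector_assoc)
  ultimately show ?thesis
    by (auto simp: Finite_Cartesian_Product.vec_eq_iff algebra_simps)
qed

lemma feasible_iff_nonneg_solution:
  fixes \<alpha> :: "'s::finite \<Rightarrow> 'a::finite \<Rightarrow> 's \<Rightarrow> real" and \<beta> :: "'s \<Rightarrow> 'o::finite \<Rightarrow> real"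
  assumes Ss: "enumerates Ss" and Os: "enumerates Os" and As: "enumerates As"
  shows "x \<in> feasible_value_functions \<alpha> \<beta> r \<gamma> \<longleftrightarrow>
    (\<exists>P\<in>carrier_vec (length Os * length As).
       C_mat \<alpha> \<beta> r \<gamma> Ss Os As x *\<^sub>v P = f_vec Ss Os x \<and> P \<ge> 0\<^sub>v (length Os * length As))"
proof -
  let ?C = "C_mat \<alpha> \<beta> r \<gamma> Ss Os As x" and ?N = "length Os * length As"
  let ?e = "\<lambda>j. List.product Os As ! j"
  have dims: "dim_row ?C = length Ss + length Os" "dim_col ?C = ?N"
    using C_mat_carrier[of \<alpha> \<beta> r \<gamma> Ss Os As x] by auto
  have e: "bij_betw ?e {..<?N} UNIV"
    using Os As by (intro bij_betw_nth) (auto simp: enumerates_def distinct_product)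
  \<comment> \<open>The product list meets each pair exactly once, so a sum over columns is a double
    sum over observations and actions.\<close>
  have sum_pairs: "(\<Sum>j<?N. g (?e j)) = (\<Sum>w\<in>UNIV. \<Sum>a\<in>UNIV. g (w, a))" for g :: "'o \<times> 'a \<Rightarrow> real"
    using sum.reindex_bij_betw[OF e, of g] by (simp add: sum.cartesian_product UNIV_Times_UNIV[symmetric] del: UNIV_Times_UNIV)
  have system: "?C *\<^sub>v vec ?N (\<lambda>j. \<pi> (fst (?e j)) (snd (?e j))) = f_vec Ss Os x \<longleftrightarrow>
      (\<forall>s. (\<Sum>w\<in>UNIV. \<Sum>a\<in>UNIV. u_vec \<alpha> \<beta> r \<gamma> x w a $h s * \<pi> w a) = x $h s) \<and>
      (\<forall>w. (\<Sum>a\<in>UNIV. \<pi> w a) = 1)" (is "?C *\<^sub>v ?P = _ \<longleftrightarrow> _") for \<pi>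
  proof -
    have mult: "(?C *\<^sub>v ?P) $ i = (\<Sum>j<?N. ?C $$ (i, j) * \<pi> (fst (?e j)) (snd (?e j)))"
      if "i < length Ss + length Os" for i
      using that by (simp add: dims scalar_prod_def lessThan_atLeast0)
    have top: "(?C *\<^sub>v ?P) $ i = (\<Sum>w\<in>UNIV. \<Sum>a\<in>UNIV. u_vec \<alpha> \<beta> r \<gamma> x w a $h (Ss ! i) * \<pi> w a)"
      if "i < length Ss" for i
      using that sum_pairs[of "\<lambda>p. u_vec \<alpha> \<beta> r \<gamma> x (fst p) (snd p) $h (Ss ! i) * \<pi> (fst p) (snd p)"]
      by (simp add: mult index_C_mat case_prod_beta Let_def)
    \<comment> \<open>An observation row keeps only the columns of its own observation, leaving the
      total mass that the policy assigns there.\<close>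
    have bot: "(?C *\<^sub>v ?P) $ (length Ss + i) = (\<Sum>a\<in>UNIV. \<pi> (Os ! i) a)" if "i < length Os" for i
    proof -
      have "(?C *\<^sub>v ?P) $ (length Ss + i)
          = (\<Sum>w\<in>UNIV. \<Sum>a\<in>UNIV. (if w = Os ! i then 1 else 0) * \<pi> w a)"
        using that sum_pairs[of "\<lambda>p. (if fst p = Os ! i then 1 else 0) * \<pi> (fst p) (snd p)"]
        by (simp add: mult index_C_mat case_prod_beta Let_def)
      also have "\<dots> = (\<Sum>w\<in>UNIV. if w = Os ! i then \<Sum>a\<in>UNIV. \<pi> w a else 0)"
        by (intro sum.cong) auto
      finally show ?thesis by simp
    qed
    have all_nth: "(\<forall>y. Q y) \<longleftrightarrow> (\<forall>i<length ys. Q (ys ! i))" if "enumerates ys" for Q and ys :: "'c list"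
      using that unfolding enumerates_def by (metis UNIV_I in_set_conv_nth)
    have all_less_add: "(\<forall>i<m + n. Q i) \<longleftrightarrow> (\<forall>i<m. Q i) \<and> (\<forall>i<n. Q (m + i))" for Q and m n :: nat
      by (auto, metis add_less_cancel_left le_add_diff_inverse not_less)
    have "?C *\<^sub>v ?P = f_vec Ss Os x \<longleftrightarrow>
        (\<forall>i<length Ss + length Os. (?C *\<^sub>v ?P) $ i = f_vec Ss Os x $ i)"
      using f_vec_carrier[of Ss Os x] dims by (auto simp: Matrix.vec_eq_iff simp del: index_mult_mat_vec)
    also have "\<dots> \<longleftrightarrow> (\<forall>i<length Ss. (?C *\<^sub>v ?P) $ i = f_vec Ss Os x $ i) \<and>
        (\<forall>i<length Os. (?C *\<^sub>v ?P) $ (length Ss + i) = f_vec Ss Os x $ (length Ss + i))"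
      by (rule all_less_add)
    also have "\<dots> \<longleftrightarrow> (\<forall>i<length Ss. (\<Sum>w\<in>UNIV. \<Sum>a\<in>UNIV. u_vec \<alpha> \<beta> r \<gamma> x w a $h (Ss ! i) * \<pi> w a) = x $h (Ss ! i)) \<and>
        (\<forall>i<length Os. (\<Sum>a\<in>UNIV. \<pi> (Os ! i) a) = 1)"
      by (simp add: top bot index_f_vec del: index_mult_mat_vec)
    finally show ?thesis
      using all_nth[OF Ss, of "\<lambda>s. (\<Sum>w\<in>UNIV. \<Sum>a\<in>UNIV. u_vec \<alpha> \<beta> r \<gamma> x w a $h s * \<pi> w a) = x $h s"]
        all_nth[OF Os, of "\<lambda>w. (\<Sum>a\<in>UNIV. \<pi> w a) = 1"] by simp
  qed
  show ?thesis
  proof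
    assume "x \<in> feasible_value_functions \<alpha> \<beta> r \<gamma>"
    then obtain \<pi> where \<pi>: "memoryless_policy \<pi>"
      "\<forall>s. (\<Sum>w\<in>UNIV. \<Sum>a\<in>UNIV. u_vec \<alpha> \<beta> r \<gamma> x w a $h s * \<pi> w a) = x $h s"
      by (auto simp: feasible_value_functions_def bellman_equation_iff)
    then show "\<exists>P\<in>carrier_vec ?N. ?C *\<^sub>v P = f_vec Ss Os x \<and> P \<ge> 0\<^sub>v ?N"
      using system[of \<pi>]
      by (intro bexI[of _ "vec ?N (\<lambda>j. \<pi> (fst (?e j)) (snd (?e j)))"])
        (auto simp: memoryless_policy_def less_eq_vec_def)
  next
    assume "\<exists>P\<in>carrier_vec ?N. ?C *\<^sub>v P = f_vec Ss Os x \<and> P \<ge> 0\<^sub>v ?N"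
    then obtain P where P: "P \<in> carrier_vec ?N" "?C *\<^sub>v P = f_vec Ss Os x" "P \<ge> 0\<^sub>v ?N" by blast
    \<comment> \<open>The pair \<open>(w, a)\<close> is sent back to its unique column, so every
      vector \<open>P\<close> arises from a function on pairs.\<close>
    define \<pi> where "\<pi> = (\<lambda>w a. P $ the_inv_into {..<?N} ?e (w, a))"
    have inv: "the_inv_into {..<?N} ?e p < ?N" for p
      using the_inv_into_into[of ?e "{..<?N}" p "{..<?N}"] e by (auto simp: bij_betw_def)
    have "P = vec ?N (\<lambda>j. \<pi> (fst (?e j)) (snd (?e j)))"
      using P(1) e by (intro eq_vecI) (auto simp: \<pi>_def bij_betw_def the_inv_into_f_f)
    then have sys: "(\<forall>s. (\<Sum>w\<in>UNIV. \<Sum>a\<in>UNIV. u_vec \<alpha> \<beta> r \<gamma> x w a $h s * \<pi> w a) = x $h s) \<and>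
      (\<forall>w. (\<Sum>a\<in>UNIV. \<pi> w a) = 1)" using P(2) system[of \<pi>] by simp
    moreover have "P $ j \<ge> 0" if "j < ?N" for j
      using P(1,3) that by (auto simp: less_eq_vec_def)
    then have "\<pi> w a \<ge> 0" for w a using inv by (simp add: \<pi>_def)
    ultimately show "x \<in> feasible_value_functions \<alpha> \<beta> r \<gamma>"
      unfolding feasible_value_functions_def bellman_equation_iff memoryless_policy_def by blast
  qed
qed

lemma length_enumerates: "enumerates (xs :: 'b list) \<Longrightarrow> length xs = CARD('b)"
  unfolding enumerates_def by (metis distinct_card)

lemma stratum_eq_cramer_certificate:
  "stratum \<alpha> \<beta> r \<gamma> Ss Os As \<rho> I B =
     {x. cramer_certificate (C_mat \<alpha> \<beta> r \<gamma> Ss Os As x) (f_vec Ss Os x) \<rho> I B}"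
  by (simp add: stratum_def cramer_certificate_def Let_def)

theorem theorem4p4:
  fixes \<alpha> :: "'s::finite \<Rightarrow> 'a::finite \<Rightarrow> 's \<Rightarrow> real"
    and \<beta> :: "'s \<Rightarrow> 'o::finite \<Rightarrow> real"
    and r :: "'s \<Rightarrow> 'a \<Rightarrow> real"
    and \<gamma> :: real
    and Ss :: "'s list" and Os :: "'o list" and As :: "'a list"
  assumes "\<And>s a s'. \<alpha> s a s' \<ge> 0" and "\<And>s a. (\<Sum>s'\<in>UNIV. \<alpha> s a s') = 1"
    and "\<And>s w. \<beta> s w \<ge> 0" and "\<And>s. (\<Sum>w\<in>UNIV. \<beta> s w) = 1"
    and "0 < \<gamma>" and "\<gamma> < 1"
    and "enumerates Ss" and "enumerates Os" and "enumerates As"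
  shows "(\<forall>x. x \<in> feasible_value_functions \<alpha> \<beta> r \<gamma> \<longleftrightarrow>
            (\<exists>P \<in> carrier_vec (CARD('o) * CARD('a)).
               C_mat \<alpha> \<beta> r \<gamma> Ss Os As x *\<^sub>v P = f_vec Ss Os x \<and>
               P \<ge> 0\<^sub>v (CARD('o) * CARD('a)))) \<and>
         feasible_value_functions \<alpha> \<beta> r \<gamma> =
            (\<Union>\<rho>\<in>{1..CARD('s) + CARD('o)}.
             \<Union>I\<in>{I. I \<subseteq> {..<CARD('s) + CARD('o)} \<and> card I = \<rho>}.
             \<Union>B\<in>{B. B \<subseteq> {..<CARD('o) * CARD('a)} \<and> card B = \<rho>}.
               stratum \<alpha> \<beta> r \<gamma> Ss Os As \<rho> I B) \<and>
         (\<forall>\<rho>\<in>{1..CARD('s) + CARD('o)}.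
            \<forall>I\<in>{I. I \<subseteq> {..<CARD('s) + CARD('o)} \<and> card I = \<rho>}.
            \<forall>B\<in>{B. B \<subseteq> {..<CARD('o) * CARD('a)} \<and> card B = \<rho>}.
               semialgebraic (stratum \<alpha> \<beta> r \<gamma> Ss Os As \<rho> I B) \<and>
               (\<forall>x \<in> stratum \<alpha> \<beta> r \<gamma> Ss Os As \<rho> I B.
                  vec_space.rank (CARD('s) + CARD('o)) (C_mat \<alpha> \<beta> r \<gamma> Ss Os As x) = \<rho>))"
    (is "?feasible \<and> ?union \<and> ?strata")
proof -
  let ?m = "CARD('s) + CARD('o)" and ?n = "CARD('o) * CARD('a)"
  let ?C = "C_mat \<alpha> \<beta> r \<gamma> Ss Os As" and ?f = "f_vec Ss Os"
  have len: "length Ss = CARD('s)" "length Os = CARD('o)" "length As = CARD('a)"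
    using length_enumerates assms(7-9) by blast+
  have C: "?C x \<in> carrier_mat ?m ?n" for x using C_mat_carrier[of \<alpha> \<beta> r \<gamma> Ss Os As x] len by simp
  have f: "?f x \<in> carrier_vec ?m" for x using f_vec_carrier[of Ss Os x] len by simp
  have f0: "?f x \<noteq> 0\<^sub>v ?m" for x
  proof
    assume "?f x = 0\<^sub>v ?m"
    \<comment> \<open>Counting from 0, this is the first entry of the block of ones; it exists
      because there is at least one observation.\<close>
    moreover have "?f x $ CARD('s) = 1" by (subst index_f_vec) (simp_all add: len)
    ultimately show False by simp
  qed
  have feasible: "x \<in> feasible_value_functions \<alpha> \<beta> r \<gamma> \<longleftrightarrow>
      (\<exists>P\<in>carrier_vec ?n. ?C x *\<^sub>v P = ?f x \<and> P \<ge> 0\<^sub>v ?n)" for x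
    using feasible_iff_nonneg_solution[OF assms(7-9), of x \<alpha> \<beta> r \<gamma>] len by simp
  have ?union
  proof (intro equalityI subsetI)
    fix x assume "x \<in> feasible_value_functions \<alpha> \<beta> r \<gamma>"
    then obtain P where P: "P \<in> carrier_vec ?n" "?C x *\<^sub>v P = ?f x" "P \<ge> 0\<^sub>v ?n"
      using feasible by blast
    show "x \<in> (\<Union>\<rho>\<in>{1..?m}. \<Union>I\<in>{I. I \<subseteq> {..<?m} \<and> card I = \<rho>}.
        \<Union>B\<in>{B. B \<subseteq> {..<?n} \<and> card B = \<rho>}. stratum \<alpha> \<beta> r \<gamma> Ss Os As \<rho> I B)"
      by (rule cramer_certificate_exists[OF C f f0 P]) (unfold stratum_eq_cramer_certificate, blast)
  next
    fix x assume "x \<in> (\<Union>\<rho>\<in>{1..?m}. \<Union>I\<in>{I. I \<subseteq> {..<?m} \<and> card I = \<rho>}.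
        \<Union>B\<in>{B. B \<subseteq> {..<?n} \<and> card B = \<rho>}. stratum \<alpha> \<beta> r \<gamma> Ss Os As \<rho> I B)"
    then obtain \<rho> I B where IB: "I \<subseteq> {..<?m}" "card I = \<rho>" "B \<subseteq> {..<?n}" "card B = \<rho>"
      "cramer_certificate (?C x) (?f x) \<rho> I B"
      unfolding stratum_eq_cramer_certificate by blast
    show "x \<in> feasible_value_functions \<alpha> \<beta> r \<gamma>"
      unfolding feasible by (rule cramer_certificate_nonneg_solution[OF C f IB]) blast
  qed
  moreover have ?strata
  proof (intro ballI conjI)
    fix \<rho> I B assume "I \<in> {I. I \<subseteq> {..<?m} \<and> card I = \<rho>}" "B \<in> {B. B \<subseteq> {..<?n} \<and> card B = \<rho>}"
    then have IB: "I \<subseteq> {..<?m}" "card I = \<rho>" "B \<subseteq> {..<?n}" "card B = \<rho>" by auto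
    show "semialgebraic (stratum \<alpha> \<beta> r \<gamma> Ss Os As \<rho> I B)"
      unfolding stratum_eq_cramer_certificate
      by (rule semialgebraic_cramer_certificate[OF polynomial_C_mat f_vec_carrier polynomial_f_vec])
        (use IB len in simp_all)
    fix x assume "x \<in> stratum \<alpha> \<beta> r \<gamma> Ss Os As \<rho> I B"
    then show "vec_space.rank ?m (?C x) = \<rho>"
      using rank_eq_block_size[OF C IB(1,3,2,4)]
      by (simp add: stratum_eq_cramer_certificate cramer_certificate_def)
  qed
  ultimately show ?thesis using feasible by blast
qed

end
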